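(* Let $n\ge1$ and $d\ge1$. The number of set partitions of $[d]=\{1,2,\dots,d\}$ into at most $n$ parts is the number of words of length $d$ which reduce to the identity in the Cayley graph $\Gamma(\mathfrak S_n,\{e,(1\,2),(1\,3\,2),\dots,(1\,n\,\cdots\,4\,3\,2)\})$.
   Context: $\mathfrak S_n$ is the symmetric group on $\{1,\dots,n\}$ with identity $e$. A set partition of $[d]$ is a family of disjoint nonempty subsets (parts) with union $[d]$. The set of generators is $S=\{e,c_2,\dots,c_n\}$ with $c_k=(1\;k\;k-1\;\cdots\;2)$ in cycle notation. In the Cayley graph $\Gamma(G,S)$ there is a directed edge $g\to gs$ for each $g\in G$, $s\in S$; a word of length $d$ which reduces to $g$ is a sequence $(s_1,\dots,s_d)\in S^d$ with $s_1\cdots s_d=g$ in $G$ (the letter $e$ is a genuine letter, counted in the length). *)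

theory Defs
  imports "HOL-Algebra.Sym_Groups" "HOL-Library.Disjoint_Sets"
begin

text \<open>A word reducing to \<open>g\<close> is the label sequence of a walk from the identity to \<open>g\<close> in the
  Cayley graph of \<open>G\<close> with edges \<open>x \<rightarrow> x \<otimes> s\<close>, \<open>s \<in> S\<close>.\<close>

definition words_reducing_to :: "('a, 'b) monoid_scheme \<Rightarrow> 'a set \<Rightarrow> nat \<Rightarrow> 'a \<Rightarrow> 'a list set" where
  "words_reducing_to G S d g =
     {w. set w \<subseteq> S \<and> length w = d \<and> foldr (\<otimes>\<^bsub>G\<^esub>) w \<one>\<^bsub>G\<^esub> = g}"

text \<open>\<open>desc_cycle k\<close> is the cycle \<open>(1 k k-1 \<dots> 2)\<close>, i.e. \<open>1 \<mapsto> k \<mapsto> k-1 \<mapsto> \<dots> \<mapsto> 2 \<mapsto> 1\<close>.\<close>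

definition desc_cycle :: "nat \<Rightarrow> nat \<Rightarrow> nat" where
  "desc_cycle k = cycle_of_list (1 # rev [2..<Suc k])"

definition cycle_generators :: "nat \<Rightarrow> (nat \<Rightarrow> nat) set" where
  "cycle_generators n = insert \<one>\<^bsub>sym_group n\<^esub> (desc_cycle ` {2..n})"

end

theory Submission
  imports Defs
begin

text \<open>
  Read a permutation \<open>g\<close> of \<open>{1..n}\<close> as a deck of cards with \<open>g i\<close> in position \<open>i\<close>.  Multiplying
  \<open>g\<close> on the right by \<open>c\<^sub>k\<close> moves the card in position \<open>k\<close> to the top and keeps the order of
  the others (for \<open>k = 1\<close> this is the letter \<open>e\<close>).  A word is therefore a sequence of
  move-to-front steps, and it may be recorded by the cards moved instead of their positions
  (\<open>moved_cards\<close>); this encodes the words of length \<open>d\<close> bijectively by all sequences \<open>xs\<close> in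
  \<open>{1..n}\<^sup>d\<close>.

  After the steps \<open>xs\<close> the deck shows the moved cards, the last moved one first, followed by the
  untouched cards in their old order (\<open>fold_move_to_front\<close>).  So the word reduces to the identity
  iff the values of \<open>xs\<close>, ordered by their last occurrence in \<open>xs\<close>, are \<open>m, m - 1, \<dots>, 1\<close> where
  \<open>m\<close> is their number.

  Such a sequence is determined by the partition of the index set into its level sets, since the
  condition prescribes which label each block receives; and every partition of the index set into
  \<open>m\<close> blocks admits exactly one such labelling, which uses the labels \<open>1, \<dots>, m\<close>
  (\<open>bij_betw_level_sets\<close>).  The labels lie in \<open>{1..n}\<close> iff \<open>m \<le> n\<close>.
\<close>

section \<open>Generators as move-to-front shuffles\<close>

definition move_to_front :: "'a \<Rightarrow> 'a list \<Rightarrow> 'a list" where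
  "move_to_front x D = x # removeAll x D"

lemma map_move_to_front:
  assumes "inj g"
  shows "map g (move_to_front x D) = move_to_front (g x) (map g D)"
proof -
  have "map g (removeAll x D) = removeAll (g x) (map g D)"
    using assms by (induction D) (auto dest: injD)
  then show ?thesis by (simp add: move_to_front_def)
qed

lemma desc_cycle_list:
  assumes "k \<ge> 1"
  shows "desc_cycle k 1 = k" "map (desc_cycle k) [2..<Suc k] = [1..<k]"
proof -
  let ?cs = "1 # rev [2..<Suc k]"
  have "map (desc_cycle k) ?cs = rotate1 ?cs"
    using cyclic_rotation[of ?cs 1] by (simp add: desc_cycle_def)
  also have "\<dots> = rev (1 # [2..<Suc k])" by simp
  also have "1 # [2..<Suc k] = [1..<Suc k]"
    using assms by (simp add: upt_conv_Cons numeral_2_eq_2 del: upt_Suc)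
  also have "rev [1..<Suc k] = k # rev [1..<k]"
    using assms by simp
  finally have *: "map (desc_cycle k) ?cs = k # rev [1..<k]" .
  then show "desc_cycle k 1 = k" by simp
  from * have "rev (map (desc_cycle k) [2..<Suc k]) = rev [1..<k]"
    by (simp add: rev_map)
  then show "map (desc_cycle k) [2..<Suc k] = [1..<k]" by (simp only: rev_is_rev_conv)
qed

lemma desc_cycle_permutes:
  assumes "k \<in> {1..n}"
  shows "desc_cycle k permutes {1..n}"
proof -
  have "desc_cycle k permutes set (1 # rev [2..<Suc k])"
    unfolding desc_cycle_def by (rule cycle_permutes)
  then show ?thesis
    by (rule permutes_subset) (use assms in auto)
qed

lemma map_desc_cycle:
  assumes "k \<in> {1..n}"
  shows "map (desc_cycle k) [1..<Suc n] = move_to_front k [1..<Suc n]"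
proof -
  have k: "1 \<le> k" "k \<le> n" using assms by auto
  have split: "[1..<Suc n] = 1 # [2..<Suc k] @ [Suc k..<Suc n]"
    using k upt_add_eq_append[of 2 "Suc k" "n - k"]
    by (simp add: upt_conv_Cons numeral_2_eq_2 del: upt_Suc)
  have "map (desc_cycle k) [Suc k..<Suc n] = [Suc k..<Suc n]"
  proof (rule map_idI)
    fix i assume "i \<in> set [Suc k..<Suc n]"
    then show "desc_cycle k i = i"
      using desc_cycle_permutes[of k k] k by (auto simp: permutes_def)
  qed
  then have "map (desc_cycle k) [1..<Suc n] = k # [1..<k] @ [Suc k..<Suc n]"
    using desc_cycle_list[OF k(1)] by (simp only: split list.map map_append)
  also have "[1..<k] @ [Suc k..<Suc n] = removeAll k ([1..<k] @ k # [Suc k..<Suc n])"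
    by (simp add: removeAll_id del: upt_Suc)
  also have "[1..<k] @ k # [Suc k..<Suc n] = [1..<Suc n]"
    using k upt_add_eq_append[of 1 k "Suc n - k"]
    by (simp add: upt_conv_Cons del: upt_Suc)
  finally show ?thesis by (simp only: move_to_front_def)
qed

text \<open>The letter \<open>e\<close> is the degenerate case \<open>k = 1\<close> of the cycles, so that a generator is the same
  thing as a position in the deck.\<close>

lemma cycle_generators_eq:
  assumes "n \<ge> 1"
  shows "cycle_generators n = desc_cycle ` {1..n}"
proof -
  have "desc_cycle 1 = id" by (simp add: desc_cycle_def)
  moreover have "{1..n} = insert 1 {2..n}" using assms by auto
  ultimately show ?thesis
    by (simp add: cycle_generators_def sym_group_def)
qed

section \<open>Words recorded by the moved cards\<close>

text \<open>Started from the deck \<open>g\<close>, the step \<open>s\<close> leads to the deck \<open>g \<circ> s\<close>; the card it moves is the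
  one then lying on top.\<close>

fun moved_cards :: "(nat \<Rightarrow> nat) \<Rightarrow> (nat \<Rightarrow> nat) list \<Rightarrow> nat list" where
  "moved_cards g [] = []"
| "moved_cards g (s # w) = g (s 1) # moved_cards (g \<circ> s) w"

lemma length_moved_cards [simp]: "length (moved_cards g w) = length w"
  by (induction w arbitrary: g) auto

lemma set_moved_cards:
  assumes "g permutes {1..n}" "set w \<subseteq> desc_cycle ` {1..n}"
  shows "set (moved_cards g w) \<subseteq> {1..n}"
  using assms
proof (induction w arbitrary: g)
  case (Cons s w)
  then obtain k where k: "k \<in> {1..n}" "s = desc_cycle k" by auto
  then have "(g \<circ> s) permutes {1..n}"
    using Cons.prems(1) desc_cycle_permutes permutes_compose by blast
  moreover have "g (s 1) \<in> {1..n}"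
    using k desc_cycle_list(1)[of k] permutes_in_image[OF Cons.prems(1)] by auto
  ultimately show ?case using Cons by auto
qed simp

text \<open>The first card tells the position it was taken from, and this position is the generator;
  so the word can be read off letter by letter.\<close>

lemma inj_on_moved_cards:
  assumes "g permutes {1..n}"
  shows "inj_on (moved_cards g) (lists (desc_cycle ` {1..n}))"
proof (rule inj_onI)
  fix w w'
  assume "w \<in> lists (desc_cycle ` {1..n})" "w' \<in> lists (desc_cycle ` {1..n})"
    and "moved_cards g w = moved_cards g w'"
  then show "w = w'" using assms
  proof (induction w arbitrary: g w' rule: list.induct)
    case Nil
    then show ?case by (cases w') auto
  next
    case (Cons s w)
    from Cons.prems(3) obtain t u where w': "w' = t # u" by (cases w') simp_all
    obtain k l where kl: "k \<in> {1..n}" "s = desc_cycle k" "l \<in> {1..n}" "t = desc_cycle l"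
      using Cons.prems w' by auto
    have "g (s 1) = g (t 1)" using Cons.prems w' by simp
    then have "s 1 = t 1" using permutes_inj[OF Cons.prems(4)] by (auto dest: injD)
    then have st: "s = t" using kl desc_cycle_list(1)[of k] desc_cycle_list(1)[of l] by auto
    have "(g \<circ> s) permutes {1..n}"
      using Cons.prems(4) kl desc_cycle_permutes permutes_compose by blast
    moreover have "moved_cards (g \<circ> s) w = moved_cards (g \<circ> s) u"
      using Cons.prems(3) by (simp only: w' st moved_cards.simps list.inject)
    moreover have "w \<in> lists (desc_cycle ` {1..n})" "u \<in> lists (desc_cycle ` {1..n})"
      using Cons.prems(1,2) w' by auto
    ultimately have "w = u" using Cons.IH by blast
    then show ?case using st w' by simp
  qed
qed

lemma moved_cards_surj:
  assumes "g permutes {1..n}" "set xs \<subseteq> {1..n}"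
  shows "\<exists>w. set w \<subseteq> desc_cycle ` {1..n} \<and> moved_cards g w = xs"
  using assms
proof (induction xs arbitrary: g)
  case Nil
  show ?case by (rule exI[of _ "[]"]) simp
next
  case (Cons x xs)
  have "x \<in> g ` {1..n}" using Cons.prems permutes_image by fastforce
  then obtain k where k: "k \<in> {1..n}" "x = g k" by auto
  have "(g \<circ> desc_cycle k) permutes {1..n}"
    using Cons.prems(1) k desc_cycle_permutes permutes_compose by blast
  then obtain w where "set w \<subseteq> desc_cycle ` {1..n}" "moved_cards (g \<circ> desc_cycle k) w = xs"
    using Cons.IH Cons.prems by fastforce
  then show ?case
    using k desc_cycle_list(1)[of k] by (intro exI[of _ "desc_cycle k # w"]) auto
qed

lemma bij_betw_moved_cards:
  assumes "g permutes {1..n}"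
  shows "bij_betw (moved_cards g) {w. set w \<subseteq> desc_cycle ` {1..n} \<and> length w = d}
           {xs. set xs \<subseteq> {1..n} \<and> length xs = d}"
proof (rule bij_betwI')
  fix w w' assume "w \<in> {w. set w \<subseteq> desc_cycle ` {1..n} \<and> length w = d}"
    "w' \<in> {w. set w \<subseteq> desc_cycle ` {1..n} \<and> length w = d}"
  then show "moved_cards g w = moved_cards g w' \<longleftrightarrow> w = w'"
    using inj_on_moved_cards[OF assms] by (auto simp: lists_eq_set inj_on_def)
next
  fix w assume "w \<in> {w. set w \<subseteq> desc_cycle ` {1..n} \<and> length w = d}"
  then show "moved_cards g w \<in> {xs. set xs \<subseteq> {1..n} \<and> length xs = d}"
    using set_moved_cards[OF assms] by auto
next
  fix xs assume xs: "xs \<in> {xs. set xs \<subseteq> {1..n} \<and> length xs = d}"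
  then obtain w where "set w \<subseteq> desc_cycle ` {1..n}" "moved_cards g w = xs"
    using moved_cards_surj[OF assms] by blast
  then show "\<exists>w \<in> {w. set w \<subseteq> desc_cycle ` {1..n} \<and> length w = d}. xs = moved_cards g w"
    using xs by auto
qed

lemma foldr_generators_permutes:
  assumes "set w \<subseteq> desc_cycle ` {1..n}"
  shows "foldr (\<circ>) w id permutes {1..n}"
  using assms
proof (induction w)
  case (Cons s w)
  then have "s permutes {1..n}" using desc_cycle_permutes by auto
  moreover have "foldr (\<circ>) w id permutes {1..n}" using Cons.IH Cons.prems by (metis list.set_intros(2) subset_code(1))
  ultimately show ?case using permutes_compose by (metis foldr.simps(2) comp_apply)
qed (simp add: permutes_id)

lemma deck_after_word:
  assumes "g permutes {1..n}" "set w \<subseteq> desc_cycle ` {1..n}"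
  shows "map (g \<circ> foldr (\<circ>) w id) [1..<Suc n] =
         fold move_to_front (moved_cards g w) (map g [1..<Suc n])"
  using assms
proof (induction w arbitrary: g)
  case (Cons s w)
  then obtain k where k: "k \<in> {1..n}" "s = desc_cycle k" by auto
  have perm: "(g \<circ> s) permutes {1..n}"
    using Cons.prems(1) k desc_cycle_permutes permutes_compose by blast
  have "map (g \<circ> s) [1..<Suc n] = map g (move_to_front k [1..<Suc n])"
    using map_desc_cycle[OF k(1)] k(2) by (metis map_map)
  also have "\<dots> = move_to_front (g (s 1)) (map g [1..<Suc n])"
    using k desc_cycle_list(1)[of k] map_move_to_front[OF permutes_inj[OF Cons.prems(1)]] by auto
  finally have "map (g \<circ> s) [1..<Suc n] = move_to_front (g (s 1)) (map g [1..<Suc n])" .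
  moreover have "map ((g \<circ> s) \<circ> foldr (\<circ>) w id) [1..<Suc n] =
      fold move_to_front (moved_cards (g \<circ> s) w) (map (g \<circ> s) [1..<Suc n])"
    by (rule Cons.IH[OF perm]) (use Cons.prems(2) in auto)
  ultimately show ?case
    by (simp only: foldr_Cons fold_Cons moved_cards.simps comp_assoc) (simp only: comp_def)
qed simp

section \<open>Sequences of moves that restore the deck\<close>

text \<open>Here \<open>remdups\<close> does the bookkeeping: it keeps the last occurrence of each element, which is
  the move that decides where the card ends up.\<close>

lemma fold_move_to_front:
  "fold move_to_front xs D = rev (remdups xs) @ filter (\<lambda>x. x \<notin> set xs) D"
proof (induction xs arbitrary: D)
  case (Cons x xs)
  have "filter (\<lambda>y. y \<notin> set xs) (removeAll x D) = filter (\<lambda>y. y \<notin> set (x # xs)) D"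
    by (induction D) auto
  moreover have "fold move_to_front (x # xs) D = fold move_to_front xs (x # removeAll x D)"
    by (simp add: move_to_front_def)
  ultimately show ?case by (simp add: Cons.IH)
qed simp

definition labelled_by_last_occurrence :: "nat list \<Rightarrow> bool" where
  "labelled_by_last_occurrence xs \<longleftrightarrow> rev (remdups xs) = [1..<Suc (card (set xs))]"

lemma set_labelled_by_last_occurrence:
  assumes "labelled_by_last_occurrence xs"
  shows "set xs = {1..card (set xs)}"
proof -
  have "set xs = set (rev (remdups xs))" by simp
  also have "\<dots> = {1..<Suc (card (set xs))}"
    using assms unfolding labelled_by_last_occurrence_def by (metis set_upt)
  finally show ?thesis by (simp add: atLeastLessThanSuc_atLeastAtMost)
qed

lemma fold_move_to_front_eq_iff:
  assumes "set xs \<subseteq> {1..n}"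
  shows "fold move_to_front xs [1..<Suc n] = [1..<Suc n] \<longleftrightarrow> labelled_by_last_occurrence xs"
proof -
  define m where "m = card (set xs)"
  have len: "length (rev (remdups xs)) = m" by (simp add: m_def length_remdups_card_conv)
  have "m \<le> card {1..n}" unfolding m_def using assms by (intro card_mono) auto
  then have "m \<le> n" by simp
  then have split: "[1..<Suc n] = [1..<Suc m] @ [Suc m..<Suc n]"
    using upt_add_eq_append[of 1 "Suc m" "n - m"] by simp
  show ?thesis
  proof
    assume "fold move_to_front xs [1..<Suc n] = [1..<Suc n]"
    then have "rev (remdups xs) @ filter (\<lambda>x. x \<notin> set xs) [1..<Suc n]
                 = [1..<Suc m] @ [Suc m..<Suc n]"
      unfolding fold_move_to_front using split by metis
    then have "rev (remdups xs) = [1..<Suc m]"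
      using len by (subst (asm) append_eq_append_conv) auto
    then show "labelled_by_last_occurrence xs"
      by (simp only: labelled_by_last_occurrence_def m_def)
  next
    assume lab: "labelled_by_last_occurrence xs"
    have "set xs = {1..m}" using set_labelled_by_last_occurrence[OF lab] by (simp add: m_def)
    then have "filter (\<lambda>x. x \<notin> set xs) [1..<Suc n] = [Suc m..<Suc n]"
      unfolding split by (simp add: filter_empty_conv filter_id_conv del: upt_Suc)
    moreover have "rev (remdups xs) = [1..<Suc m]"
      using lab by (simp only: labelled_by_last_occurrence_def m_def)
    ultimately show "fold move_to_front xs [1..<Suc n] = [1..<Suc n]"
      unfolding fold_move_to_front using split by simp
  qed
qed

lemma card_words_eq_card_labelled:
  assumes "n \<ge> 1"
  shows "card (words_reducing_to (sym_group n) (cycle_generators n) d \<one>\<^bsub>sym_group n\<^esub>) =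
         card {xs. length xs = d \<and> labelled_by_last_occurrence xs \<and> card (set xs) \<le> n}"
proof -
  let ?W = "{w. set w \<subseteq> desc_cycle ` {1..n} \<and> length w = d}"
  have words: "words_reducing_to (sym_group n) (cycle_generators n) d \<one>\<^bsub>sym_group n\<^esub> =
      {w \<in> ?W. foldr (\<circ>) w id = id}"
    using cycle_generators_eq[OF assms]
    by (auto simp: words_reducing_to_def sym_group_def)
  have iff: "labelled_by_last_occurrence (moved_cards id w) \<longleftrightarrow> foldr (\<circ>) w id = id"
    if "w \<in> ?W" for w
  proof -
    have w: "set w \<subseteq> desc_cycle ` {1..n}" using that by simp
    let ?p = "foldr (\<circ>) w id"
    have "?p = id \<longleftrightarrow> map ?p [1..<Suc n] = [1..<Suc n]"
    proof
      assume "map ?p [1..<Suc n] = [1..<Suc n]"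
      then have "?p i = i" if "i \<in> {1..n}" for i
        using that map_eq_conv[of ?p "[1..<Suc n]" id]
        by (auto simp del: upt_Suc)
      then show "?p = id"
        using foldr_generators_permutes[OF w] by (metis eq_id_iff permutes_not_in)
    qed simp
    also have "\<dots> \<longleftrightarrow> fold move_to_front (moved_cards id w) [1..<Suc n] = [1..<Suc n]"
      using deck_after_word[OF permutes_id w] by (simp del: upt_Suc)
    also have "\<dots> \<longleftrightarrow> labelled_by_last_occurrence (moved_cards id w)"
      using set_moved_cards[OF permutes_id w] by (rule fold_move_to_front_eq_iff)
    finally show ?thesis by simp
  qed
  have "bij_betw (moved_cards id) {w \<in> ?W. foldr (\<circ>) w id = id}
      {xs \<in> {xs. set xs \<subseteq> {1..n} \<and> length xs = d}. labelled_by_last_occurrence xs}"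
    using bij_betw_moved_cards[OF permutes_id] iff
    by (rule bij_betw_Collect)
  also have "{xs \<in> {xs. set xs \<subseteq> {1..n} \<and> length xs = d}. labelled_by_last_occurrence xs} =
      {xs. length xs = d \<and> labelled_by_last_occurrence xs \<and> card (set xs) \<le> n}"
  proof -
    have "set xs \<subseteq> {1..n} \<longleftrightarrow> card (set xs) \<le> n" if lab: "labelled_by_last_occurrence xs" for xs
    proof -
      have "set xs \<subseteq> {1..n} \<longleftrightarrow> {1..card (set xs)} \<subseteq> {1..n}"
        using set_labelled_by_last_occurrence[OF lab] by simp
      then show ?thesis by auto
    qed
    then show ?thesis by blast
  qed
  finally show ?thesis
    unfolding words by (rule bij_betw_same_card)
qed

section \<open>Labelled sequences and set partitions\<close>

text \<open>The index shift makes the level sets of a sequence of length \<open>d\<close> subsets of \<open>{1..d}\<close>,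
  the set to be partitioned.\<close>

definition level_set :: "'a list \<Rightarrow> 'a \<Rightarrow> nat set" where
  "level_set xs v = {i \<in> {1..length xs}. xs ! (i - 1) = v}"

definition level_sets :: "'a list \<Rightarrow> nat set set" where
  "level_sets xs = level_set xs ` set xs"

lemma level_set_nonempty:
  assumes "v \<in> set xs"
  shows "level_set xs v \<noteq> {}"
proof -
  obtain j where "j < length xs" "xs ! j = v" using assms by (auto simp: in_set_conv_nth)
  then have "Suc j \<in> level_set xs v" by (auto simp: level_set_def)
  then show ?thesis by blast
qed

lemma inj_on_level_set: "inj_on (level_set xs) (set xs)"
proof (rule inj_onI)
  fix u v assume "u \<in> set xs" "level_set xs u = level_set xs v"
  then obtain i where "i \<in> level_set xs u" "i \<in> level_set xs v"
    using level_set_nonempty[of u xs] by auto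
  then show "u = v" by (simp add: level_set_def)
qed

lemma card_level_sets: "card (level_sets xs) = card (set xs)"
  unfolding level_sets_def by (rule card_image[OF inj_on_level_set])

lemma partition_on_level_sets: "partition_on {1..length xs} (level_sets xs)"
proof (rule partition_onI)
  show "\<Union> (level_sets xs) = {1..length xs}"
  proof
    show "{1..length xs} \<subseteq> \<Union> (level_sets xs)"
    proof
      fix i assume i: "i \<in> {1..length xs}"
      then have "i \<in> level_set xs (xs ! (i - 1))" by (simp add: level_set_def)
      moreover have "xs ! (i - 1) \<in> set xs" using i by (intro nth_mem) auto
      ultimately show "i \<in> \<Union> (level_sets xs)" by (auto simp: level_sets_def)
    qed
  qed (auto simp: level_sets_def level_set_def)
next
  fix p q assume "p \<in> level_sets xs" "q \<in> level_sets xs" "p \<noteq> q"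
  then show "disjnt p q" by (auto simp: level_sets_def level_set_def disjnt_def)
next
  show "{} \<notin> level_sets xs" unfolding level_sets_def using level_set_nonempty by (metis imageE)
qed

lemma remdups_map_inj_on:
  assumes "inj_on h (set xs)"
  shows "remdups (map h xs) = map h (remdups xs)"
  using assms by (induction xs) auto

text \<open>Two sequences with the same level sets differ by an injective relabelling.  It commutes with
  \<open>remdups\<close>, so the labelling condition forces it to fix every label.\<close>

lemma level_sets_inject:
  assumes "labelled_by_last_occurrence xs" "labelled_by_last_occurrence ys"
    and len: "length xs = length ys"
    and eq: "level_sets xs = level_sets ys"
  shows "xs = ys"
proof -
  have card: "card (set xs) = card (set ys)" using eq card_level_sets by metis
  have same: "ys ! i = ys ! j \<longleftrightarrow> xs ! i = xs ! j"
    if ij: "i < length xs" "j < length xs" for i j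
  proof -
    have *: "zs ! i = zs ! j \<longleftrightarrow> (\<exists>B \<in> level_sets zs. Suc i \<in> B \<and> Suc j \<in> B)"
      if "length zs = length xs" for zs :: "nat list"
      using ij that by (auto simp: level_sets_def level_set_def)
    show ?thesis using *[of xs] *[of ys] eq len by simp
  qed
  define h where "h v = ys ! (SOME j. j < length xs \<and> xs ! j = v)" for v
  have h: "h (xs ! i) = ys ! i" if "i < length xs" for i
  proof -
    have "\<exists>j. j < length xs \<and> xs ! j = xs ! i" using that by blast
    from someI_ex[OF this] show ?thesis unfolding h_def using same that by blast
  qed
  then have ys: "ys = map h xs" using len by (auto intro: nth_equalityI)
  have "inj_on h (set xs)"
    by (rule inj_onI) (use h same in \<open>auto simp: in_set_conv_nth\<close>)
  then have "rev (remdups ys) = map h (rev (remdups xs))"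
    unfolding ys by (simp add: remdups_map_inj_on rev_map)
  moreover have "rev (remdups ys) = rev (remdups xs)"
    using assms(1,2) card by (simp only: labelled_by_last_occurrence_def)
  ultimately have "map h (rev (remdups xs)) = map id (rev (remdups xs))" by simp
  then have "h v = v" if "v \<in> set xs" for v
    using that unfolding map_eq_conv by simp
  then show ?thesis unfolding ys by (simp add: map_idI)
qed

lemma distinct_list_enumeration:
  assumes "distinct rs"
  obtains h where "map h rs = [1..<Suc (length rs)]"
proof
  show "map (\<lambda>r. Suc (inv_into {..<length rs} (nth rs) r)) rs = [1..<Suc (length rs)]"
  proof (rule nth_equalityI)
    fix i assume "i < length (map (\<lambda>r. Suc (inv_into {..<length rs} (nth rs) r)) rs)"
    moreover from this have "[1..<Suc (length rs)] ! i = Suc i"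
      by (subst nth_upt) auto
    moreover have "inj_on (nth rs) {..<length rs}"
      using assms by (simp add: inj_on_nth)
    ultimately show "map (\<lambda>r. Suc (inv_into {..<length rs} (nth rs) r)) rs ! i
        = [1..<Suc (length rs)] ! i"
      by (simp add: inv_into_f_f del: upt_Suc)
  qed (simp del: upt_Suc)
qed

text \<open>The blocks themselves, listed along the index set, form a sequence with the right level sets.
  Numbering them by their last occurrence, from the right, turns it into a labelled one.\<close>

lemma ex_labelled_with_level_sets:
  assumes P: "partition_on {1..d} P"
  obtains xs where "length xs = d" "labelled_by_last_occurrence xs" "level_sets xs = P"
proof -
  have ex1: "\<exists>!B. B \<in> P \<and> i \<in> B" if "i \<in> {1..d}" for i
    using that P unfolding partition_on_def disjoint_def by blast
  define b where "b i = (THE B. B \<in> P \<and> i \<in> B)" for i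
  have b: "b i \<in> P" "i \<in> b i" if "i \<in> {1..d}" for i
    using theI'[OF ex1[OF that]] unfolding b_def by auto
  have b_eq: "b i = B" if "B \<in> P" "i \<in> B" for i B
  proof -
    have "i \<in> {1..d}" using that partition_onD1[OF P] by blast
    then show ?thesis using b ex1 that by blast
  qed
  define bs where "bs = map b [1..<Suc d]"
  have "b ` {1..d} = P"
  proof
    show "P \<subseteq> b ` {1..d}"
    proof
      fix B assume B: "B \<in> P"
      then obtain i where i: "i \<in> B" using partition_onD3[OF P] by (metis ex_in_conv)
      then have "i \<in> {1..d}" using B partition_onD1[OF P] by blast
      then show "B \<in> b ` {1..d}" using b_eq[OF B i] by blast
    qed
  qed (use b in auto)
  then have set_bs: "set bs = P"
    by (simp add: bs_def atLeastLessThanSuc_atLeastAtMost del: upt_Suc)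
  obtain h where h: "map h (rev (remdups bs)) = [1..<Suc (length (rev (remdups bs)))]"
    by (rule distinct_list_enumeration[of "rev (remdups bs)"]) auto
  have "distinct (map h (rev (remdups bs)))" unfolding h by simp
  then have inj: "inj_on h P"
    unfolding distinct_map using set_bs by simp
  define xs where "xs = map h bs"
  have len: "length xs = d" by (simp add: xs_def bs_def)
  have card: "card (set xs) = length (rev (remdups bs))"
    using inj set_bs by (simp add: xs_def card_image length_remdups_card_conv)
  have "rev (remdups xs) = map h (rev (remdups bs))"
    using inj set_bs by (simp add: xs_def remdups_map_inj_on rev_map)
  then have "labelled_by_last_occurrence xs"
    unfolding labelled_by_last_occurrence_def card using h by simp
  moreover have "level_set xs (h B) = B" if B: "B \<in> P" for B
  proof -
    have nth: "xs ! (i - 1) = h (b i)" if "i \<in> {1..d}" for i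
    proof -
      have "[1..<Suc d] ! (i - 1) = i" using that by (subst nth_upt) auto
      moreover have "i - 1 < length [1..<Suc d]" using that by auto
      ultimately show ?thesis unfolding xs_def bs_def by (simp only: nth_map length_map)
    qed
    have "xs ! (i - 1) = h B \<longleftrightarrow> i \<in> B" if i: "i \<in> {1..d}" for i
      using nth[OF i] inj_onD[OF inj _ b(1)[OF i] B] b(2)[OF i] b_eq[OF B] by metis
    moreover have "B \<subseteq> {1..d}" using B partition_onD1[OF P] by blast
    ultimately show ?thesis unfolding level_set_def len by blast
  qed
  then have "level_sets xs = P"
    by (simp add: level_sets_def xs_def set_bs image_image)
  ultimately show thesis using that len by blast
qed

lemma bij_betw_level_sets:
  "bij_betw level_sets
     {xs. length xs = d \<and> labelled_by_last_occurrence xs \<and> card (set xs) \<le> n}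
     {P. partition_on {1..d} P \<and> card P \<le> n}"
proof (rule bij_betw_imageI)
  show "inj_on level_sets
     {xs. length xs = d \<and> labelled_by_last_occurrence xs \<and> card (set xs) \<le> n}"
    by (rule inj_onI) (auto intro: level_sets_inject)
next
  show "level_sets ` {xs. length xs = d \<and> labelled_by_last_occurrence xs \<and> card (set xs) \<le> n} =
     {P. partition_on {1..d} P \<and> card P \<le> n}"
  proof (intro equalityI subsetI)
    fix P assume "P \<in> {P. partition_on {1..d} P \<and> card P \<le> n}"
    then have P: "partition_on {1..d} P" "card P \<le> n" by auto
    obtain xs where xs: "length xs = d" "labelled_by_last_occurrence xs" "level_sets xs = P"
      using ex_labelled_with_level_sets[OF P(1)] .
    then show "P \<in> level_sets `
        {xs. length xs = d \<and> labelled_by_last_occurrence xs \<and> card (set xs) \<le> n}"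
      using P(2) card_level_sets[of xs] by (intro image_eqI[of _ _ xs]) auto
  qed (use partition_on_level_sets in \<open>auto simp: card_level_sets\<close>)
qed

theorem corollary4p25:
  fixes n d :: nat
  assumes "n \<ge> 1" and "d \<ge> 1"
  shows "card {P. partition_on {1..d} P \<and> card P \<le> n} =
         card (words_reducing_to (sym_group n) (cycle_generators n) d \<one>\<^bsub>sym_group n\<^esub>)"
  using bij_betw_same_card[OF bij_betw_level_sets] card_words_eq_card_labelled[OF assms(1)]
  by simp

end
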